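(* (Monotone Convergence Theorem.) Let $X$ be a Banach space over $\mathbb{C}$, $(\Omega,\Sigma)$ a measurable space, and $\mu=\{\mu_{\Lambda,x} \mid \Lambda\in X^*,\ x\in X\}$ an operator projection family. Let $(f_n)_{n\in\mathbb{N}}$ be a non-decreasing sequence of non-negative functions in $L^1(\mu)$ such that $f_n\to f$ pointwise. If $f\in L^1(\mu)$, then, for each $x\in X$, $$\int f_n\,d\mu(x)\to\int f\,d\mu(x)$$ in the weak-$*$ topology of $X^{**}$.
   Context: $\mathcal{M}(\Omega)$ is the space of complex measures on $(\Omega,\Sigma)$. A net $(\mu_i)$ in $\mathcal{M}(\Omega)$ converges setwise to $\mu$ if $\mu_i(E)\to\mu(E)$ for every $E\in\Sigma$. An operator projection family is a collection $\{\mu_{\Lambda,x} \mid \Lambda\in X^*,\ x\in X\}\subset\mathcal{M}(\Omega)$ such that (1) $(\Lambda,x)\mapsto\mu_{\Lambda,x}$ is bilinear from $X^*\times X$ to $\mathcal{M}(\Omega)$; (2) if nets $\Lambda_i\to\Lambda$ in $X^*$ and $x_j\to x$ in $X$ converge in norm, then $\mu_{\Lambda_i,x}\to\mu_{\Lambda,x}$ and $\mu_{\Lambda,x_j}\to\mu_{\Lambda,x}$ setwise. A measurable $f\colon\Omega\to\mathbb{C}$ belongs to $L^1(\mu)$ if $f\in L^1(\mu_{\Lambda,x})$ (that is, $\int|f|\,d|\mu_{\Lambda,x}|<\infty$) for all $\Lambda\in X^*$, $x\in X$. For $f\in L^1(\mu)$ and $x\in X$, $\int f\,d\mu(x)$ is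 the map $X^*\to\mathbb{C}$, $\Lambda\mapsto\int_\Omega f\,d\mu_{\Lambda,x}$; it is an element of $X^{**}$. The weak-$*$ topology of $X^{**}$ is the topology of pointwise convergence on $X^*$. *)

theory Defs
  imports "HOL-Analysis.Analysis"
begin

section \<open>Complex Banach spaces and their duals\<close>

class complex_normed_vector = real_normed_vector +
  fixes scaleC :: "complex \<Rightarrow> 'a \<Rightarrow> 'a"  (infixr "*\<^sub>C" 75)
  assumes scaleC_add_right: "a *\<^sub>C (x + y) = a *\<^sub>C x + a *\<^sub>C y"
    and scaleC_add_left: "(a + b) *\<^sub>C x = a *\<^sub>C x + b *\<^sub>C x"
    and scaleC_scaleC: "a *\<^sub>C b *\<^sub>C x = (a * b) *\<^sub>C x"
    and scaleC_of_real: "complex_of_real r *\<^sub>C x = r *\<^sub>R x"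
    and norm_scaleC: "norm (a *\<^sub>C x) = cmod a * norm x"

class complex_banach = complex_normed_vector + complete_space

subclass (in complex_banach) banach ..

definition bounded_clinear_functional :: "('a::complex_normed_vector \<Rightarrow> complex) \<Rightarrow> bool" where
  "bounded_clinear_functional \<phi> \<longleftrightarrow>
     bounded_linear \<phi> \<and> (\<forall>c x. \<phi> (c *\<^sub>C x) = c * \<phi> x)"

text \<open>
  The dual space is cut out of the bounded real-linear maps, from which it inherits
  the operator norm.
\<close>

typedef (overloaded) 'a cdual =
    "{\<Lambda> :: 'a::complex_normed_vector \<Rightarrow>\<^sub>L complex. bounded_clinear_functional (blinfun_apply \<Lambda>)}"
  morphisms blinfun_of_cdual Abs_cdual
  by (rule exI[of _ 0]) (simp add: bounded_clinear_functional_def blinfun.bounded_linear_right)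

setup_lifting type_definition_cdual

lift_definition cdual_apply :: "'a::complex_normed_vector cdual \<Rightarrow> 'a \<Rightarrow> complex" is blinfun_apply .

instantiation cdual :: (complex_normed_vector) complex_normed_vector
begin

lift_definition zero_cdual :: "'a cdual" is 0
  by (simp add: bounded_clinear_functional_def blinfun.bounded_linear_right)

lift_definition plus_cdual :: "'a cdual \<Rightarrow> 'a cdual \<Rightarrow> 'a cdual" is "(+)"
  by (auto simp: bounded_clinear_functional_def blinfun.bilinear_simps algebra_simps
      intro!: blinfun.bounded_linear_right)

lift_definition uminus_cdual :: "'a cdual \<Rightarrow> 'a cdual" is uminus
  by (auto simp: bounded_clinear_functional_def blinfun.bilinear_simps
      intro!: blinfun.bounded_linear_right)

lift_definition minus_cdual :: "'a cdual \<Rightarrow> 'a cdual \<Rightarrow> 'a cdual" is "(-)"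
  by (auto simp: bounded_clinear_functional_def blinfun.bilinear_simps algebra_simps
      intro!: blinfun.bounded_linear_right)

lift_definition scaleR_cdual :: "real \<Rightarrow> 'a cdual \<Rightarrow> 'a cdual" is scaleR
  by (auto simp: bounded_clinear_functional_def blinfun.bilinear_simps
      intro!: blinfun.bounded_linear_right)

lift_definition scaleC_cdual :: "complex \<Rightarrow> 'a cdual \<Rightarrow> 'a cdual" is
  "\<lambda>c \<Lambda>. blinfun_compose (blinfun_mult_right c) \<Lambda>"
  by (auto simp: bounded_clinear_functional_def blinfun.bounded_linear_right)

lift_definition norm_cdual :: "'a cdual \<Rightarrow> real" is norm .

definition dist_cdual :: "'a cdual \<Rightarrow> 'a cdual \<Rightarrow> real" where
  "dist_cdual a b = norm (a - b)"

definition sgn_cdual :: "'a cdual \<Rightarrow> 'a cdual" where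
  "sgn_cdual x = scaleR (inverse (norm x)) x"

definition [code del]:
  "(uniformity :: ('a cdual \<times> 'a cdual) filter) = (INF e\<in>{0 <..}. principal {(x, y). dist x y < e})"

definition open_cdual :: "'a cdual set \<Rightarrow> bool" where
  [code del]: "open_cdual S = (\<forall>x\<in>S. \<forall>\<^sub>F (x', y) in uniformity. x' = x \<longrightarrow> y \<in> S)"

instance
proof
  fix x y z :: "'a cdual" and a b :: complex and r s :: real
  show "x + y + z = x + (y + z)" "x + y = y + x" "0 + x = x" "- x + x = 0" "x - y = x + - y"
    "r *\<^sub>R (x + y) = r *\<^sub>R x + r *\<^sub>R y" "(r + s) *\<^sub>R x = r *\<^sub>R x + s *\<^sub>R x"
    "r *\<^sub>R s *\<^sub>R x = (r * s) *\<^sub>R x" "1 *\<^sub>R x = x"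
    by (transfer; simp add: algebra_simps)+
  show "a *\<^sub>C (x + y) = a *\<^sub>C x + a *\<^sub>C y" "(a + b) *\<^sub>C x = a *\<^sub>C x + b *\<^sub>C x"
    "a *\<^sub>C b *\<^sub>C x = (a * b) *\<^sub>C x" "complex_of_real r *\<^sub>C x = r *\<^sub>R x"
    by (transfer; auto intro!: blinfun_eqI simp: blinfun.bilinear_simps algebra_simps scaleR_conv_of_real)+
  show "norm (r *\<^sub>R x) = \<bar>r\<bar> * norm x" "norm (x + y) \<le> norm x + norm y" "(norm x = 0) = (x = 0)"
    by (transfer; simp add: norm_triangle_ineq)+
  show "dist x y = norm (x - y)" by (rule dist_cdual_def)
  show "sgn x = inverse (norm x) *\<^sub>R x" by (rule sgn_cdual_def)
  show "(uniformity :: ('a cdual \<times> 'a cdual) filter) = (INF e\<in>{0 <..}. principal {(x, y). dist x y < e})"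
    by (rule uniformity_cdual_def)
  fix U :: "'a cdual set"
  show "open U = (\<forall>x\<in>U. \<forall>\<^sub>F (x', y) in uniformity. x' = x \<longrightarrow> y \<in> U)"
    by (rule open_cdual_def)
next
  fix a :: complex and x :: "'a cdual"
  show "norm (a *\<^sub>C x) = cmod a * norm x"
  proof (transfer, rule antisym)
    fix a :: complex and L :: "'a \<Rightarrow>\<^sub>L complex"
    show "norm (blinfun_compose (blinfun_mult_right a) L) \<le> cmod a * norm L"
      by (rule norm_blinfun_bound)
        (auto simp: norm_mult mult.assoc intro!: mult_left_mono norm_blinfun)
    show "cmod a * norm L \<le> norm (blinfun_compose (blinfun_mult_right a) L)"
    proof (cases "a = 0")
      case False
      have "norm L \<le> norm (blinfun_compose (blinfun_mult_right a) L) / cmod a"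
      proof (rule norm_blinfun_bound)
        fix x
        have "cmod a * norm (blinfun_apply L x)
            \<le> norm (blinfun_compose (blinfun_mult_right a) L) * norm x"
          using norm_blinfun[of "blinfun_compose (blinfun_mult_right a) L" x] by (simp add: norm_mult)
        with False show "norm (blinfun_apply L x)
            \<le> norm (blinfun_compose (blinfun_mult_right a) L) / cmod a * norm x"
          by (simp add: field_simps)
      qed simp
      with False show ?thesis by (simp add: field_simps)
    qed simp
  qed
qed

end

lemma cdual_apply_simps:
  "cdual_apply (\<Lambda> + \<Lambda>') x = cdual_apply \<Lambda> x + cdual_apply \<Lambda>' x"
  "cdual_apply (c *\<^sub>C \<Lambda>) x = c * cdual_apply \<Lambda> x"
  by (transfer; simp add: blinfun.bilinear_simps)+

lemma norm_cdual_eq_onorm: "norm \<Lambda> = onorm (cdual_apply \<Lambda>)"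
  by transfer (rule norm_blinfun.rep_eq)

text \<open>
  The weak-* topology on the dual of \<open>'a\<close>.  For \<open>'a = 'x cdual\<close> its underlying set is the
  bidual of \<open>'x\<close>, so a limit in this topology is in particular an element of the bidual.
\<close>

definition weak_star_topology :: "('a::complex_normed_vector \<Rightarrow> complex) topology" where
  "weak_star_topology =
     subtopology (product_topology (\<lambda>_. euclidean) UNIV) {\<phi>. bounded_clinear_functional \<phi>}"

lemma topspace_weak_star: "topspace weak_star_topology = {\<phi>. bounded_clinear_functional \<phi>}"
  by (simp add: weak_star_topology_def)

lemma limitin_weak_star_iff:
  "limitin weak_star_topology \<phi> \<psi> F \<longleftrightarrow>
     bounded_clinear_functional \<psi> \<and> (\<forall>\<^sub>F i in F. bounded_clinear_functional (\<phi> i)) \<and>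
     (\<forall>\<Lambda>. ((\<lambda>i. \<phi> i \<Lambda>) \<longlongrightarrow> \<psi> \<Lambda>) F)"
  by (auto simp: weak_star_topology_def limitin_subtopology limitin_componentwise)

section \<open>Complex measures\<close>

text \<open>
  A value \<open>M :: 'o measure\<close> stands for the measurable space \<open>(space M, sets M)\<close>; its
  \<open>emeasure\<close> is never used.  A complex measure is a set function whose values outside
  \<open>sets M\<close> are irrelevant, so equality of complex measures means equality on \<open>sets M\<close>.
\<close>

definition complex_measure :: "'o measure \<Rightarrow> ('o set \<Rightarrow> complex) \<Rightarrow> bool" where
  "complex_measure M \<nu> \<longleftrightarrow>
     (\<forall>A :: nat \<Rightarrow> 'o set. range A \<subseteq> sets M \<longrightarrow> disjoint_family A \<longrightarrow>
        (\<lambda>n. \<nu> (A n)) sums \<nu> (\<Union>n. A n))"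

definition setwise_tendsto ::
    "'o measure \<Rightarrow> ('i \<Rightarrow> 'o set \<Rightarrow> complex) \<Rightarrow> ('o set \<Rightarrow> complex) \<Rightarrow> 'i filter \<Rightarrow> bool" where
  "setwise_tendsto M \<nu> \<nu>' F \<longleftrightarrow> (\<forall>E\<in>sets M. ((\<lambda>i. \<nu> i E) \<longlongrightarrow> \<nu>' E) F)"

text \<open>Supremum over all countable measurable partitions.\<close>

definition total_variation :: "'o measure \<Rightarrow> ('o set \<Rightarrow> complex) \<Rightarrow> 'o measure" where
  "total_variation M \<nu> = measure_of (space M) (sets M)
     (\<lambda>E. SUP A \<in> {A :: nat \<Rightarrow> 'o set. range A \<subseteq> sets M \<and> disjoint_family A \<and> (\<Union>n. A n) = E}.
            \<Sum>n. ennreal (cmod (\<nu> (A n))))"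

text \<open>
  The positive part in the Jordan decomposition of a real signed measure \<open>\<sigma>\<close>; the negative
  part is the positive part of \<open>- \<sigma>\<close>.  Negative values are truncated to 0 by \<open>ennreal\<close>, which
  does not affect the supremum because \<open>A = {}\<close> contributes 0.
\<close>

definition positive_part :: "'o measure \<Rightarrow> ('o set \<Rightarrow> real) \<Rightarrow> 'o measure" where
  "positive_part M \<sigma> = measure_of (space M) (sets M)
     (\<lambda>E. SUP A \<in> {A \<in> sets M. A \<subseteq> E}. ennreal (\<sigma> A))"

definition signed_integral :: "'o measure \<Rightarrow> ('o set \<Rightarrow> real) \<Rightarrow> ('o \<Rightarrow> complex) \<Rightarrow> complex" where
  "signed_integral M \<sigma> f =
     integral\<^sup>L (positive_part M \<sigma>) f - integral\<^sup>L (positive_part M (\<lambda>E. - \<sigma> E)) f"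

definition complex_integral :: "'o measure \<Rightarrow> ('o set \<Rightarrow> complex) \<Rightarrow> ('o \<Rightarrow> complex) \<Rightarrow> complex" where
  "complex_integral M \<nu> f =
     signed_integral M (\<lambda>E. Re (\<nu> E)) f + \<i> * signed_integral M (\<lambda>E. Im (\<nu> E)) f"

section \<open>Operator projection families\<close>

text \<open>
  In the two continuity conditions a net \<open>i \<mapsto> \<Lambda>\<^sub>i\<close> is represented by the image in the dual
  of its tail filter; quantifying over all filters \<open>F\<close> on the dual thus covers nets with
  arbitrary index sets (see \<open>tendsto_net_functional\<close> and \<open>tendsto_net_vector\<close>).
\<close>

locale operator_projection_family =
  fixes M :: "'o measure"
    and \<mu> :: "'x::complex_banach cdual \<Rightarrow> 'x \<Rightarrow> 'o set \<Rightarrow> complex"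
  assumes complex_measure: "complex_measure M (\<mu> \<Lambda> x)"
    and add_left: "E \<in> sets M \<Longrightarrow> \<mu> (\<Lambda> + \<Lambda>') x E = \<mu> \<Lambda> x E + \<mu> \<Lambda>' x E"
    and scale_left: "E \<in> sets M \<Longrightarrow> \<mu> (c *\<^sub>C \<Lambda>) x E = c * \<mu> \<Lambda> x E"
    and add_right: "E \<in> sets M \<Longrightarrow> \<mu> \<Lambda> (x + x') E = \<mu> \<Lambda> x E + \<mu> \<Lambda> x' E"
    and scale_right: "E \<in> sets M \<Longrightarrow> \<mu> \<Lambda> (c *\<^sub>C x) E = c * \<mu> \<Lambda> x E"
    and setwise_left: "((\<lambda>\<Lambda>'. \<Lambda>') \<longlongrightarrow> \<Lambda>) F \<Longrightarrow> setwise_tendsto M (\<lambda>\<Lambda>'. \<mu> \<Lambda>' x) (\<mu> \<Lambda> x) F"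
    and setwise_right: "((\<lambda>x'. x') \<longlongrightarrow> x) G \<Longrightarrow> setwise_tendsto M (\<lambda>x'. \<mu> \<Lambda> x') (\<mu> \<Lambda> x) G"
begin

lemma tendsto_net_functional:
  assumes "(L \<longlongrightarrow> \<Lambda>) F"
  shows "setwise_tendsto M (\<lambda>i. \<mu> (L i) x) (\<mu> \<Lambda> x) F"
  using setwise_left[of \<Lambda> "filtermap L F" x] assms
  by (simp add: setwise_tendsto_def filterlim_filtermap)

lemma tendsto_net_vector:
  assumes "(y \<longlongrightarrow> x) F"
  shows "setwise_tendsto M (\<lambda>i. \<mu> \<Lambda> (y i)) (\<mu> \<Lambda> x) F"
  using setwise_right[of x "filtermap y F" \<Lambda>] assms
  by (simp add: setwise_tendsto_def filterlim_filtermap)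

end

definition opf_L1 ::
    "'o measure \<Rightarrow> ('x::complex_banach cdual \<Rightarrow> 'x \<Rightarrow> 'o set \<Rightarrow> complex) \<Rightarrow> ('o \<Rightarrow> complex) set" where
  "opf_L1 M \<mu> = {f \<in> borel_measurable M.
     \<forall>\<Lambda> x. (\<integral>\<^sup>+\<omega>. ennreal (cmod (f \<omega>)) \<partial>total_variation M (\<mu> \<Lambda> x)) < \<infinity>}"

definition opf_integral ::
    "'o measure \<Rightarrow> ('x::complex_banach cdual \<Rightarrow> 'x \<Rightarrow> 'o set \<Rightarrow> complex) \<Rightarrow> ('o \<Rightarrow> complex) \<Rightarrow>
     'x \<Rightarrow> ('x cdual \<Rightarrow> complex)" where
  "opf_integral M \<mu> f x = (\<lambda>\<Lambda>. complex_integral M (\<mu> \<Lambda> x) f)"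

end

(* By monotonicity, f dominates all f_n, so dominated convergence for the four positive finite
   measures in the Jordan decompositions of the real and imaginary parts of mu_{Lambda,x}, each of
   which lies below the total variation, gives convergence at every Lambda.

   That the integral of g in L^1(mu) is bounded in Lambda uses the same dominated convergence: choose
   simple s_k -> g with |s_k| <= 2|g|.  The integral of s_k is a finite combination of values
   mu_{Lambda,x}(E), hence linear and norm continuous in Lambda, and a pointwise limit of such maps
   on the Banach space X^* is bounded by the uniform boundedness principle. *)

theory Submission
  imports Defs
begin

section \<open>Countably additive set functions\<close>

text \<open>The target is any normed space, so that complex measures and their real and imaginary
  parts share one set of lemmas.\<close>

definition vector_measure :: "'o measure \<Rightarrow> ('o set \<Rightarrow> 'b::real_normed_vector) \<Rightarrow> bool" where
  "vector_measure M \<nu> \<longleftrightarrow>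
     (\<forall>A :: nat \<Rightarrow> 'o set. range A \<subseteq> sets M \<longrightarrow> disjoint_family A \<longrightarrow>
        (\<lambda>n. \<nu> (A n)) sums \<nu> (\<Union>n. A n))"

lemma complex_measure_iff_vector_measure: "complex_measure M \<nu> \<longleftrightarrow> vector_measure M \<nu>"
  by (simp add: complex_measure_def vector_measure_def)

lemma vector_measure_sums:
  assumes "vector_measure M \<nu>" "range A \<subseteq> sets M" "disjoint_family A"
  shows "(\<lambda>n. \<nu> (A n)) sums \<nu> (\<Union>n. A n)"
  using assms by (auto simp: vector_measure_def)

lemma vector_measure_linear_image:
  assumes "bounded_linear h" "vector_measure M \<nu>"
  shows "vector_measure M (\<lambda>E. h (\<nu> E))"
  unfolding vector_measure_def
  by (auto intro!: bounded_linear.sums[OF assms(1)] vector_measure_sums[OF assms(2)])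

lemma vector_measure_uminus: "vector_measure M \<sigma> \<Longrightarrow> vector_measure M (\<lambda>E. - \<sigma> E)"
  by (rule vector_measure_linear_image[OF bounded_linear_minus[OF bounded_linear_ident]])

lemma vector_measure_empty:
  assumes "vector_measure M \<nu>"
  shows "\<nu> {} = 0"
proof -
  have "(\<lambda>n. \<nu> ((\<lambda>n::nat. {}) n)) sums \<nu> (\<Union>n::nat. {})"
    by (rule vector_measure_sums[OF assms]) (auto simp: disjoint_family_on_def)
  then show ?thesis
    \<comment> \<open>A constant series converges only if its term is 0.\<close>
    using sums_summable summable_const_iff by fastforce
qed

lemma vector_measure_Un:
  assumes "vector_measure M \<nu>" "A \<in> sets M" "B \<in> sets M" "A \<inter> B = {}"
  shows "\<nu> (A \<union> B) = \<nu> A + \<nu> B"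
proof -
  have "(\<lambda>n. \<nu> (binaryset A B n)) sums \<nu> (\<Union>n. binaryset A B n)"
    using assms by (intro vector_measure_sums[OF assms(1)])
      (auto simp: range_binaryset_eq disjoint_family_on_def binaryset_def)
  moreover have "(\<lambda>n. \<nu> (binaryset A B n)) sums (\<nu> A + \<nu> B)"
    by (rule binaryset_sums) (rule vector_measure_empty[OF assms(1)])
  ultimately show ?thesis
    by (simp add: UN_binaryset_eq sums_unique2)
qed

lemma vector_measure_Diff:
  assumes "vector_measure M \<nu>" "A \<in> sets M" "E \<in> sets M" "A \<subseteq> E"
  shows "\<nu> (E - A) = \<nu> E - \<nu> A"
  using vector_measure_Un[OF assms(1), of A "E - A"] assms
  by (simp add: Un_absorb1 Diff_disjoint sets.Diff)

text \<open>Finiteness of the positive parts rests on this bound; only then can they be subtracted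
  from each other in the reals.\<close>

lemma vector_measure_bounded:
  fixes \<nu> :: "'o set \<Rightarrow> 'b::real_normed_vector"
  assumes \<nu>: "vector_measure M \<nu>"
  obtains B where "\<And>A. A \<in> sets M \<Longrightarrow> norm (\<nu> A) \<le> B"
proof -
  define bd where "bd E \<longleftrightarrow> (\<exists>B. \<forall>A\<in>sets M. A \<subseteq> E \<longrightarrow> norm (\<nu> A) \<le> B)" for E
  have bd_Un: "bd E" if "bd A" "bd (E - A)" "A \<in> sets M" "E \<in> sets M" for A E
  proof -
    from that(1) obtain B where B: "\<And>S. S \<in> sets M \<Longrightarrow> S \<subseteq> A \<Longrightarrow> norm (\<nu> S) \<le> B"
      unfolding bd_def by blast
    from that(2) obtain C where C: "\<And>S. S \<in> sets M \<Longrightarrow> S \<subseteq> E - A \<Longrightarrow> norm (\<nu> S) \<le> C"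
      unfolding bd_def by blast
    have "norm (\<nu> S) \<le> B + C" if S: "S \<in> sets M" "S \<subseteq> E" for S
    proof -
      have "\<nu> S = \<nu> (S \<inter> A) + \<nu> (S - A)"
        using vector_measure_Un[OF \<nu>, of "S \<inter> A" "S - A"] S \<open>A \<in> sets M\<close>
        by (simp add: Int_Diff_Un Int_Diff_disjoint)
      moreover have "norm (\<nu> (S \<inter> A)) \<le> B" "norm (\<nu> (S - A)) \<le> C"
        using S \<open>A \<in> sets M\<close> by (auto intro!: B C)
      ultimately show ?thesis
        by (metis add_mono norm_triangle_le)
    qed
    then show ?thesis
      unfolding bd_def by blast
  qed
  \<comment> \<open>If \<open>\<nu>\<close> is unbounded on \<open>E\<close>, then it is unbounded on one of \<open>A\<close>, \<open>E - A\<close> for every \<open>A \<subseteq> E\<close>,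
    and both values are large once \<open>\<nu> A\<close> is much larger than \<open>\<nu> E\<close>; iterating peels off
    disjoint sets whose values do not tend to 0.\<close>
  have split: "\<exists>F\<in>sets M. F \<subseteq> E \<and> \<not> bd F \<and> 1 \<le> norm (\<nu> (E - F))"
    if E: "E \<in> sets M" "\<not> bd E" for E
  proof -
    obtain A where A: "A \<in> sets M" "A \<subseteq> E" "norm (\<nu> E) + 1 < norm (\<nu> A)"
      using E(2) unfolding bd_def by (meson not_le)
    have "1 \<le> norm (\<nu> A)" "1 \<le> norm (\<nu> (E - A))"
      using A norm_triangle_ineq2[of "\<nu> A" "\<nu> E"] norm_ge_zero[of "\<nu> E"]
      by (auto simp: vector_measure_Diff[OF \<nu> A(1) E(1) A(2)] norm_minus_commute
          simp del: norm_ge_zero)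
    moreover have "E - (E - A) = A"
      using A(2) by blast
    moreover have "\<not> bd A \<or> \<not> bd (E - A)"
      using bd_Un A(1) E by blast
    \<comment> \<open>The witness is whichever of \<open>A\<close> and \<open>E - A\<close> fails
      \<open>bd\<close>. What it leaves of \<open>E\<close> is the other one, hence the lower bound
      on both norms.\<close>
    ultimately show ?thesis
      using A(1,2) E(1) by (metis Diff_subset sets.Diff)
  qed
  have "bd (space M)"
  proof (rule ccontr)
    assume "\<not> bd (space M)"
    then have "\<exists>S. \<forall>n. (S n \<in> sets M \<and> \<not> bd (S n)) \<and>
        (S (Suc n) \<subseteq> S n \<and> 1 \<le> norm (\<nu> (S n - S (Suc n))))"
      by (intro dependent_nat_choice) (use split in blast)+
    then obtain S where S: "\<And>n. S n \<in> sets M" "\<And>n. S (Suc n) \<subseteq> S n"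
      "\<And>n. 1 \<le> norm (\<nu> (S n - S (Suc n)))"
      by blast
    have dec: "S n \<subseteq> S m" if "m \<le> n" for m n
      using lift_Suc_antimono_le[of S] S(2) that by blast
    have "disjoint_family (\<lambda>n. S n - S (Suc n))"
      unfolding disjoint_family_on_def
    proof (intro ballI impI)
      fix m n :: nat assume "m \<noteq> n"
      then consider "Suc m \<le> n" | "Suc n \<le> m" by linarith
      then show "(S m - S (Suc m)) \<inter> (S n - S (Suc n)) = {}"
        by cases (use dec in blast)+
    qed
    then have "(\<lambda>n. \<nu> (S n - S (Suc n))) sums \<nu> (\<Union>n. S n - S (Suc n))"
      using S(1) by (intro vector_measure_sums[OF \<nu>]) auto
    then have "(\<lambda>n. norm (\<nu> (S n - S (Suc n)))) \<longlonglongrightarrow> 0"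
      using sums_summable summable_LIMSEQ_zero tendsto_norm_zero by blast
    then show False
      using S(3) LIMSEQ_le_const[of _ 0 1] by force
  qed
  then show ?thesis
    using that sets.sets_into_space unfolding bd_def by metis
qed

section \<open>The Jordan decomposition and the total variation\<close>

text \<open>Superadditivity on pairs gives monotonicity and, by induction, bounds finite partial
  sums by the value of the whole union; letting the sums grow yields the inequality opposite to
  \<open>sub\<close>. Positive part and total variation are suprema, for which these two
  inequalities are the accessible ones.\<close>

lemma countably_additive_superadditive:
  fixes \<phi> :: "'o set \<Rightarrow> ennreal"
  assumes empty: "\<phi> {} = 0"
    and super: "\<And>A B. A \<in> sets M \<Longrightarrow> B \<in> sets M \<Longrightarrow> A \<inter> B = {} \<Longrightarrow> \<phi> A + \<phi> B \<le> \<phi> (A \<union> B)"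
    and sub: "\<And>A :: nat \<Rightarrow> 'o set. range A \<subseteq> sets M \<Longrightarrow> disjoint_family A \<Longrightarrow> \<phi> (\<Union>n. A n) \<le> (\<Sum>n. \<phi> (A n))"
  shows "countably_additive (sets M) \<phi>"
proof (rule countably_additiveI)
  fix A :: "nat \<Rightarrow> 'o set"
  assume A: "range A \<subseteq> sets M" "disjoint_family A" and UN: "(\<Union>n. A n) \<in> sets M"
  have Am: "A n \<in> sets M" for n using A by blast
  have mono: "\<phi> S \<le> \<phi> E" if "S \<in> sets M" "E \<in> sets M" "S \<subseteq> E" for S E
  proof -
    have "\<phi> S \<le> \<phi> S + \<phi> (E - S)" by simp
    also have "\<dots> \<le> \<phi> (S \<union> (E - S))" using that by (intro super) auto
    also have "S \<union> (E - S) = E" using that by blast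
    finally show ?thesis .
  qed
  have fin: "(\<Sum>n<N. \<phi> (A n)) \<le> \<phi> (\<Union>n<N. A n)" for N
  proof (induction N)
    case (Suc N)
    have "(\<Sum>n<Suc N. \<phi> (A n)) \<le> \<phi> (\<Union>n<N. A n) + \<phi> (A N)"
      using Suc by (simp add: add_right_mono)
    also have "\<dots> \<le> \<phi> ((\<Union>n<N. A n) \<union> A N)"
      proof (rule super)
      show "(\<Union>n<N. A n) \<inter> A N = {}"
        using disjoint_family_onD[OF A(2), of _ N] by fastforce
    qed (use Am in auto)
    also have "(\<Union>n<N. A n) \<union> A N = (\<Union>n<Suc N. A n)"
      by (auto simp: lessThan_Suc)
    finally show ?case .
  qed (simp add: empty)
  have "(\<Sum>n. \<phi> (A n)) \<le> \<phi> (\<Union>n. A n)"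
  proof (rule suminf_le_const)
    fix N
    show "(\<Sum>n<N. \<phi> (A n)) \<le> \<phi> (\<Union>n. A n)"
      by (rule order_trans[OF fin mono]) (use Am UN in auto)
  qed simp
  with sub[OF A] show "(\<Sum>n. \<phi> (A n)) = \<phi> (\<Union>n. A n)"
    by (rule antisym[rotated])
qed

text \<open>In \<open>ennreal\<close>, adding a constant commutes with a supremum over a nonempty
  set, so the two suprema can be taken one after the other.\<close>

lemma ennreal_SUP_add_SUP_le:
  fixes f :: "'a \<Rightarrow> ennreal" and g :: "'b \<Rightarrow> ennreal"
  assumes "I \<noteq> {}" "J \<noteq> {}" "\<And>i j. i \<in> I \<Longrightarrow> j \<in> J \<Longrightarrow> f i + g j \<le> c"
  shows "(SUP i\<in>I. f i) + (SUP j\<in>J. g j) \<le> c"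
proof -
  have "(SUP i\<in>I. f i) + (SUP j\<in>J. g j) = (SUP i\<in>I. SUP j\<in>J. f i + g j)"
    using assms(1,2) by (simp add: ennreal_SUP_add_left[symmetric] ennreal_SUP_add_right[symmetric])
  also have "\<dots> \<le> c"
    by (intro SUP_least assms(3))
  finally show ?thesis .
qed

section \<open>Positive parts and the Jordan decomposition\<close>

lemma sets_positive_part [simp, measurable_cong]: "sets (positive_part M \<sigma>) = sets M"
  by (simp add: positive_part_def)

lemma space_positive_part [simp]: "space (positive_part M \<sigma>) = space M"
  by (simp add: positive_part_def)

lemma sets_total_variation [simp, measurable_cong]: "sets (total_variation M \<nu>) = sets M"
  by (simp add: total_variation_def)

text \<open>\<open>measure_of\<close> takes the prescribed values once these are known to be
  countably additive. For superadditivity, subsets of two disjoint sets are united; for the other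
  inequality, a subset of a countable union is cut along the pieces.\<close>

lemma emeasure_positive_part:
  assumes \<sigma>: "vector_measure M \<sigma>" and E: "E \<in> sets M"
  shows "emeasure (positive_part M \<sigma>) E = (SUP A \<in> {A \<in> sets M. A \<subseteq> E}. ennreal (\<sigma> A))"
  unfolding positive_part_def
proof (rule emeasure_measure_of_sigma[OF sets.sigma_algebra_axioms _ _ E])
  let ?\<phi> = "\<lambda>E. SUP A \<in> {A \<in> sets M. A \<subseteq> E}. ennreal (\<sigma> A)"
  note empty = vector_measure_empty[OF \<sigma>]
  have "{A \<in> sets M. A \<subseteq> {}} = {{}}" by auto
  then have \<phi>_empty: "?\<phi> {} = 0" by (simp add: empty)
  then show "positive (sets M) ?\<phi>" by (simp add: positive_def)
  have upper: "ennreal (\<sigma> A) \<le> ?\<phi> E" if "A \<in> sets M" "A \<subseteq> E" for A E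
    using that by (intro SUP_upper) auto
  show "countably_additive (sets M) ?\<phi>"
  proof (rule countably_additive_superadditive[of ?\<phi>, OF \<phi>_empty])
    fix E F assume EF: "E \<in> sets M" "F \<in> sets M" "E \<inter> F = {}"
    show "?\<phi> E + ?\<phi> F \<le> ?\<phi> (E \<union> F)"
    proof (rule ennreal_SUP_add_SUP_le)
      fix A B assume A: "A \<in> {A \<in> sets M. A \<subseteq> E}" and B: "B \<in> {A \<in> sets M. A \<subseteq> F}"
      have "\<sigma> (A \<union> B) = \<sigma> A + \<sigma> B"
        using A B EF by (intro vector_measure_Un[OF \<sigma>]) auto
      \<comment> \<open>The union attains the sum when both values are nonnegative. A negative value
        truncates to 0, and then a single one of the sets attains it.\<close>
      then have "ennreal (\<sigma> A) + ennreal (\<sigma> B) \<in> {ennreal (\<sigma> A), ennreal (\<sigma> B), ennreal (\<sigma> (A \<union> B))}"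
        by (cases "\<sigma> A \<ge> 0"; cases "\<sigma> B \<ge> 0") (auto simp: ennreal_neg)
      then show "ennreal (\<sigma> A) + ennreal (\<sigma> B) \<le> ?\<phi> (E \<union> F)"
        using A B by (auto intro!: upper)
    qed auto
  next
    fix A :: "nat \<Rightarrow> 'a set" assume A: "range A \<subseteq> sets M" "disjoint_family A"
    show "?\<phi> (\<Union>n. A n) \<le> (\<Sum>n. ?\<phi> (A n))"
    proof (rule SUP_least)
      fix S assume S: "S \<in> {S \<in> sets M. S \<subseteq> (\<Union>n. A n)}"
      have "(\<lambda>n. \<sigma> (S \<inter> A n)) sums \<sigma> (\<Union>n. S \<inter> A n)"
        using A S by (intro vector_measure_sums[OF \<sigma>]) (auto simp: disjoint_family_on_def)
      moreover have "(\<Union>n. S \<inter> A n) = S" using S by blast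
      ultimately have "(\<lambda>N. ennreal (\<Sum>n<N. \<sigma> (S \<inter> A n))) \<longlonglongrightarrow> ennreal (\<sigma> S)"
        by (simp add: sums_def)
      then show "ennreal (\<sigma> S) \<le> (\<Sum>n. ?\<phi> (A n))"
      proof (rule LIMSEQ_le_const2, intro exI[of _ 0] allI impI)
        fix N
        \<comment> \<open>Since \<open>ennreal\<close> distributes over sums of nonnegative reals,
          negative terms are first replaced by 0.\<close>
        have "(\<Sum>n<N. \<sigma> (S \<inter> A n)) \<le> (\<Sum>n<N. max 0 (\<sigma> (S \<inter> A n)))"
          by (intro sum_mono) simp
        then have "ennreal (\<Sum>n<N. \<sigma> (S \<inter> A n)) \<le> ennreal (\<Sum>n<N. max 0 (\<sigma> (S \<inter> A n)))"
          by (rule ennreal_leI)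
        also have "\<dots> = (\<Sum>n<N. ennreal (max 0 (\<sigma> (S \<inter> A n))))"
          by (simp add: sum_ennreal)
        also have "\<dots> \<le> (\<Sum>n<N. ?\<phi> (A n))"
        proof (rule sum_mono)
          fix n show "ennreal (max 0 (\<sigma> (S \<inter> A n))) \<le> ?\<phi> (A n)"
            using upper[of "S \<inter> A n" "A n"] S A by (auto simp: max_def ennreal_neg)
        qed
        also have "\<dots> \<le> (\<Sum>n. ?\<phi> (A n))"
          by (rule sum_le_suminf) auto
        finally show "ennreal (\<Sum>n<N. \<sigma> (S \<inter> A n)) \<le> (\<Sum>n. ?\<phi> (A n))" .
      qed
    qed
  qed
qed

lemma finite_measure_positive_part:
  assumes \<sigma>: "vector_measure M \<sigma>"
  shows "finite_measure (positive_part M \<sigma>)"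
proof (rule finite_measureI)
  obtain B where B: "\<And>A. A \<in> sets M \<Longrightarrow> norm (\<sigma> A) \<le> B"
    using vector_measure_bounded[OF \<sigma>] by blast
  have "emeasure (positive_part M \<sigma>) (space M) \<le> ennreal B"
    unfolding emeasure_positive_part[OF \<sigma> sets.top]
    by (auto intro!: SUP_least ennreal_leI order_trans[OF abs_ge_self] B[simplified])
  then show "emeasure (positive_part M \<sigma>) (space (positive_part M \<sigma>)) \<noteq> \<infinity>"
    by (auto simp: top_unique)
qed

text \<open>Since \<open>\<sigma> A = \<sigma> E + (- \<sigma> (E - A))\<close>, the Jordan decomposition needs no Hahn decomposition.\<close>

lemma measure_positive_part_le:
  assumes \<sigma>: "vector_measure M \<sigma>" and E: "E \<in> sets M"
  shows "measure (positive_part M \<sigma>) E \<le> \<sigma> E + measure (positive_part M (\<lambda>E. - \<sigma> E)) E"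
proof -
  have \<sigma>': "vector_measure M (\<lambda>E. - \<sigma> E)"
    by (rule vector_measure_uminus[OF \<sigma>])
  let ?N = "positive_part M (\<lambda>E. - \<sigma> E)"
  interpret P: finite_measure "positive_part M \<sigma>" by (rule finite_measure_positive_part[OF \<sigma>])
  interpret N: finite_measure ?N by (rule finite_measure_positive_part[OF \<sigma>'])
  have N: "- \<sigma> A \<le> measure ?N E" if "A \<in> sets M" "A \<subseteq> E" for A
  proof -
    have "ennreal (- \<sigma> A) \<le> emeasure ?N E"
      unfolding emeasure_positive_part[OF \<sigma>' E] using that by (intro SUP_upper) auto
    then show ?thesis
      by (simp add: N.emeasure_eq_measure)
  qed
  have "emeasure (positive_part M \<sigma>) E \<le> ennreal (\<sigma> E + measure ?N E)"
    unfolding emeasure_positive_part[OF \<sigma> E]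
  proof (intro SUP_least ennreal_leI)
    fix A assume "A \<in> {A \<in> sets M. A \<subseteq> E}"
    then show "\<sigma> A \<le> \<sigma> E + measure ?N E"
      using N[of "E - A"] E vector_measure_Diff[OF \<sigma>, of A E] by auto
  qed
  \<comment> \<open>The choice \<open>A = E\<close> in \<open>N\<close> gives the sign needed to
    return from \<open>ennreal\<close> to the reals.\<close>
  moreover have "0 \<le> \<sigma> E + measure ?N E"
    using N[OF E] by simp
  ultimately show ?thesis
    by (simp add: P.emeasure_eq_measure)
qed

text \<open>The preceding inequality, applied to \<open>\<sigma>\<close> and to its negative, bounds
  the difference from both sides.\<close>

lemma measure_positive_part_diff:
  assumes \<sigma>: "vector_measure M \<sigma>" and E: "E \<in> sets M"
  shows "measure (positive_part M \<sigma>) E - measure (positive_part M (\<lambda>E. - \<sigma> E)) E = \<sigma> E"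
proof -
  from measure_positive_part_le[OF vector_measure_uminus[OF \<sigma>] E] measure_positive_part_le[OF \<sigma> E] show ?thesis
    by simp
qed

section \<open>The total variation and its comparison with positive parts\<close>

lemma ennreal_suminf_swap:
  fixes f :: "nat \<Rightarrow> nat \<Rightarrow> ennreal"
  shows "(\<Sum>m. \<Sum>n. f m n) = (\<Sum>n. \<Sum>m. f m n)"
  \<comment> \<open>Tonelli for counting measure: one series is read as an integral over the
    naturals.\<close>
  using nn_integral_suminf[of "\<lambda>n m. f m n" "count_space UNIV"]
  by (simp add: nn_integral_count_space_nat)

text \<open>Countable additivity again splits into two inequalities. Partitions of two disjoint sets
  are interleaved for one; for the other, a partition of a union is refined by the pieces, and the
  triangle inequality and an exchange of sums finish.\<close>

lemma emeasure_total_variation: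
  assumes \<nu>: "complex_measure M \<nu>" and E: "E \<in> sets M"
  shows "emeasure (total_variation M \<nu>) E =
    (SUP A \<in> {A :: nat \<Rightarrow> 'o set. range A \<subseteq> sets M \<and> disjoint_family A \<and> (\<Union>n. A n) = E}.
       \<Sum>n. ennreal (cmod (\<nu> (A n))))"
  unfolding total_variation_def
proof (rule emeasure_measure_of_sigma[OF sets.sigma_algebra_axioms _ _ E])
  let ?part = "\<lambda>E. {A :: nat \<Rightarrow> 'o set. range A \<subseteq> sets M \<and> disjoint_family A \<and> (\<Union>n. A n) = E}"
  let ?\<phi> = "\<lambda>E. SUP A \<in> ?part E. \<Sum>n. ennreal (cmod (\<nu> (A n)))"
  note \<nu>' = \<nu>[unfolded complex_measure_iff_vector_measure]
  note empty = vector_measure_empty[OF \<nu>']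
  have "?\<phi> {} \<le> 0"
    by (rule SUP_least) (auto simp: empty)
  then have \<phi>_empty: "?\<phi> {} = 0" by simp
  then show "positive (sets M) ?\<phi>" by (simp add: positive_def)
  have ne: "?part E \<noteq> {}" if "E \<in> sets M" for E
  proof -
    \<comment> \<open>The trivial partition, \<open>E\<close> followed by empty sets, makes the
      index sets of the suprema nonempty.\<close>
    have "binaryset E {} \<in> ?part E"
      using that by (auto simp: range_binaryset_eq UN_binaryset_eq disjoint_family_on_def binaryset_def)
    then show ?thesis by blast
  qed
  show "countably_additive (sets M) ?\<phi>"
  proof (rule countably_additive_superadditive[of ?\<phi>, OF \<phi>_empty])
    fix E F assume EF: "E \<in> sets M" "F \<in> sets M" "E \<inter> F = {}"
    show "?\<phi> E + ?\<phi> F \<le> ?\<phi> (E \<union> F)"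
    proof (rule ennreal_SUP_add_SUP_le[OF ne[OF EF(1)] ne[OF EF(2)]])
      fix A B assume A: "A \<in> ?part E" and B: "B \<in> ?part F"
      \<comment> \<open>Even positions list \<open>A\<close>, odd positions list
        \<open>B\<close>.\<close>
      define C where "C n = (if even n then A (n div 2) else B (n div 2))" for n
      have AE: "A n \<subseteq> E" and BF: "B n \<subseteq> F" for n
        using A B by auto
      have "disjoint_family C"
        unfolding disjoint_family_on_def
      proof (intro ballI impI)
        fix m n :: nat assume "m \<noteq> n"
        \<comment> \<open>Distinct indices of equal parity have distinct halves; indices of
          different parity select pieces of the disjoint sets \<open>E\<close> and
          \<open>F\<close>.\<close>
        then have "m div 2 \<noteq> n div 2" if "even m = even n"
          using that by (metis div_mult_mod_eq even_iff_mod_2_eq_zero odd_iff_mod_2_eq_one)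
        moreover have "A i \<inter> A j = {}" "B i \<inter> B j = {}" if "i \<noteq> j" for i j
          using that A B by (auto simp: disjoint_family_on_def)
        moreover have "A i \<inter> B j = {}" "B i \<inter> A j = {}" for i j
          using AE[of i] BF[of j] AE[of j] BF[of i] EF(3) by blast+
        ultimately show "C m \<inter> C n = {}"
          unfolding C_def by auto
      qed
      moreover have "(\<Union>n. C n) = E \<union> F"
      proof -
        have "A n = C (2 * n)" "B n = C (2 * n + 1)" for n
          by (auto simp: C_def)
        then have "A n \<subseteq> (\<Union>n. C n)" "B n \<subseteq> (\<Union>n. C n)" for n
          by (metis UN_upper UNIV_I)+
        then have "(\<Union>n. A n) \<union> (\<Union>n. B n) \<subseteq> (\<Union>n. C n)"
          by blast
        then have "E \<union> F \<subseteq> (\<Union>n. C n)"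
          using A B by simp
        moreover have "C n \<subseteq> E \<union> F" for n
          using AE BF by (simp add: C_def le_supI1 le_supI2)
        ultimately show ?thesis by blast
      qed
      moreover have "range C \<subseteq> sets M"
        using A B by (auto simp: C_def)
      ultimately have C: "C \<in> ?part (E \<union> F)" by simp
      have "(\<Sum>n. ennreal (cmod (\<nu> (A n)))) + (\<Sum>n. ennreal (cmod (\<nu> (B n)))) =
          (\<Sum>n. ennreal (cmod (\<nu> (A n))) + ennreal (cmod (\<nu> (B n))))"
        by (rule suminf_add) auto
      also have "\<dots> \<le> (\<Sum>n. ennreal (cmod (\<nu> (C n))))"
      proof (rule suminf_le_const)
        fix N
        \<comment> \<open>The first \<open>N\<close> pairs are exactly the first
          \<open>2 * N\<close> terms of the interleaved sequence.\<close>
        have "(\<Sum>n<N. ennreal (cmod (\<nu> (A n))) + ennreal (cmod (\<nu> (B n)))) =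
            (\<Sum>n<2 * N. ennreal (cmod (\<nu> (C n))))"
          by (induction N) (simp_all add: C_def add.assoc)
        also have "\<dots> \<le> (\<Sum>n. ennreal (cmod (\<nu> (C n))))"
          by (rule sum_le_suminf) auto
        finally show "(\<Sum>n<N. ennreal (cmod (\<nu> (A n))) + ennreal (cmod (\<nu> (B n))))
            \<le> (\<Sum>n. ennreal (cmod (\<nu> (C n))))" .
      qed simp
      also have "\<dots> \<le> ?\<phi> (E \<union> F)"
        using C by (rule SUP_upper)
      finally show "(\<Sum>n. ennreal (cmod (\<nu> (A n)))) + (\<Sum>n. ennreal (cmod (\<nu> (B n)))) \<le> ?\<phi> (E \<union> F)" .
    qed
  next
    fix A :: "nat \<Rightarrow> 'o set" assume A: "range A \<subseteq> sets M" "disjoint_family A"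
    show "?\<phi> (\<Union>n. A n) \<le> (\<Sum>n. ?\<phi> (A n))"
    proof (rule SUP_least)
      fix S assume S: "S \<in> ?part (\<Union>n. A n)"
      have "(\<Sum>m. ennreal (cmod (\<nu> (S m)))) \<le> (\<Sum>m. \<Sum>n. ennreal (cmod (\<nu> (S m \<inter> A n))))"
      proof (rule suminf_le)
        fix m
        have "(\<lambda>n. \<nu> (S m \<inter> A n)) sums \<nu> (\<Union>n. S m \<inter> A n)"
          using A S by (intro vector_measure_sums[OF \<nu>']) (auto simp: disjoint_family_on_def)
        moreover have "(\<Union>n. S m \<inter> A n) = S m" using S by blast
        ultimately have "(\<lambda>N. ennreal (cmod (\<Sum>n<N. \<nu> (S m \<inter> A n)))) \<longlonglongrightarrow> ennreal (cmod (\<nu> (S m)))"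
          by (intro tendsto_ennrealI tendsto_norm) (simp add: sums_def)
        then show "ennreal (cmod (\<nu> (S m))) \<le> (\<Sum>n. ennreal (cmod (\<nu> (S m \<inter> A n))))"
        proof (rule LIMSEQ_le_const2, intro exI[of _ 0] allI impI)
          fix N
          have "ennreal (cmod (\<Sum>n<N. \<nu> (S m \<inter> A n))) \<le> ennreal (\<Sum>n<N. cmod (\<nu> (S m \<inter> A n)))"
            by (intro ennreal_leI norm_sum)
          also have "\<dots> = (\<Sum>n<N. ennreal (cmod (\<nu> (S m \<inter> A n))))"
            by (simp add: sum_ennreal)
          also have "\<dots> \<le> (\<Sum>n. ennreal (cmod (\<nu> (S m \<inter> A n))))"
            by (rule sum_le_suminf) auto
          finally show "ennreal (cmod (\<Sum>n<N. \<nu> (S m \<inter> A n)))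
              \<le> (\<Sum>n. ennreal (cmod (\<nu> (S m \<inter> A n))))" .
        qed
      qed auto
      also have "\<dots> = (\<Sum>n. \<Sum>m. ennreal (cmod (\<nu> (S m \<inter> A n))))"
        by (rule ennreal_suminf_swap)
      also have "\<dots> \<le> (\<Sum>n. ?\<phi> (A n))"
      proof (rule suminf_le)
        fix n
        \<comment> \<open>After the exchange of sums, \<open>n\<close> is fixed, and the sets
          \<open>S m\<close> cut \<open>A n\<close> into a partition of it.\<close>
        have "(\<lambda>m. S m \<inter> A n) \<in> ?part (A n)"
          using S A disjoint_family_subset[of S "\<lambda>m. S m \<inter> A n"] by auto
        then show "(\<Sum>m. ennreal (cmod (\<nu> (S m \<inter> A n)))) \<le> ?\<phi> (A n)"
          by (rule SUP_upper2) simp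
      qed auto
      finally show "(\<Sum>m. ennreal (cmod (\<nu> (S m)))) \<le> (\<Sum>n. ?\<phi> (A n))" .
    qed
  qed
qed

text \<open>A competitor \<open>A\<close> for the positive part extends to the partition of
  \<open>E\<close> into \<open>A\<close> and \<open>E - A\<close>, where it contributes a single
  term. This carries integrability over from the total variation.\<close>

lemma positive_part_le_total_variation:
  assumes \<nu>: "complex_measure M \<nu>" and \<sigma>: "vector_measure M \<sigma>"
    and le: "\<And>E. E \<in> sets M \<Longrightarrow> \<sigma> E \<le> cmod (\<nu> E)"
  shows "positive_part M \<sigma> \<le> total_variation M \<nu>"
  unfolding le_measure[of "positive_part M \<sigma>" "total_variation M \<nu>", simplified]
proof (intro ballI)
  fix E assume E: "E \<in> sets M"
  show "emeasure (positive_part M \<sigma>) E \<le> emeasure (total_variation M \<nu>) E"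
    unfolding emeasure_positive_part[OF \<sigma> E] emeasure_total_variation[OF \<nu> E]
  proof (intro SUP_least)
    fix A assume A: "A \<in> {A \<in> sets M. A \<subseteq> E}"
    have "ennreal (\<sigma> A) \<le> ennreal (cmod (\<nu> A))"
      using A by (intro ennreal_leI le) auto
    also have "\<dots> = ennreal (cmod (\<nu> (binaryset A (E - A) 0)))"
      by (simp add: binaryset_def)
    also have "\<dots> \<le> (\<Sum>n. ennreal (cmod (\<nu> (binaryset A (E - A) n))))"
      by (rule order_trans[OF _ sum_le_suminf[of _ "{0}"]]) (rule summableI | simp)+
    also have "\<dots> \<le> (SUP A \<in> {A :: nat \<Rightarrow> _ set. range A \<subseteq> sets M \<and> disjoint_family A \<and> (\<Union>n. A n) = E}.
       \<Sum>n. ennreal (cmod (\<nu> (A n))))"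
      using A E by (intro SUP_upper)
        (auto simp: range_binaryset_eq UN_binaryset_eq disjoint_family_on_def binaryset_def)
    finally show "ennreal (\<sigma> A) \<le> (SUP A \<in> {A :: nat \<Rightarrow> _ set. range A \<subseteq> sets M \<and> disjoint_family A \<and> (\<Union>n. A n) = E}.
       \<Sum>n. ennreal (cmod (\<nu> (A n))))" .
  qed
qed

section \<open>Integration against complex measures\<close>

lemma vector_measure_Re: "complex_measure M \<nu> \<Longrightarrow> vector_measure M (\<lambda>E. Re (\<nu> E))"
  unfolding complex_measure_iff_vector_measure by (rule vector_measure_linear_image[OF bounded_linear_Re])

lemma vector_measure_Im: "complex_measure M \<nu> \<Longrightarrow> vector_measure M (\<lambda>E. Im (\<nu> E))"
  unfolding complex_measure_iff_vector_measure by (rule vector_measure_linear_image[OF bounded_linear_Im])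

text \<open>The dominating function is a multiple of the limit itself. The factor \<open>c\<close>
  is 2 for simple approximations and 1 for the monotone sequence.\<close>

lemma integral_positive_part_dominated:
  fixes s :: "nat \<Rightarrow> 'o \<Rightarrow> complex"
  assumes \<nu>: "complex_measure M \<nu>" and \<sigma>: "vector_measure M \<sigma>"
    and le: "\<And>E. E \<in> sets M \<Longrightarrow> \<sigma> E \<le> cmod (\<nu> E)"
    and f: "f \<in> borel_measurable M" "(\<integral>\<^sup>+\<omega>. ennreal (cmod (f \<omega>)) \<partial>total_variation M \<nu>) < \<infinity>"
    and s: "\<And>n. s n \<in> borel_measurable M"
    and lim: "\<And>\<omega>. \<omega> \<in> space M \<Longrightarrow> (\<lambda>n. s n \<omega>) \<longlonglongrightarrow> f \<omega>"
    and bound: "\<And>n \<omega>. \<omega> \<in> space M \<Longrightarrow> cmod (s n \<omega>) \<le> c * cmod (f \<omega>)"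
  shows "(\<lambda>n. integral\<^sup>L (positive_part M \<sigma>) (s n)) \<longlonglongrightarrow> integral\<^sup>L (positive_part M \<sigma>) f"
proof (rule integral_dominated_convergence[where w = "\<lambda>\<omega>. c * cmod (f \<omega>)"])
  have "(\<integral>\<^sup>+\<omega>. ennreal (cmod (f \<omega>)) \<partial>positive_part M \<sigma>) \<le> (\<integral>\<^sup>+\<omega>. ennreal (cmod (f \<omega>)) \<partial>total_variation M \<nu>)"
    by (rule nn_integral_mono_measure[OF _ positive_part_le_total_variation[OF \<nu> \<sigma> le]]) simp_all
  then have "integrable (positive_part M \<sigma>) f"
    using f by (intro integrableI_bounded) (auto intro: le_less_trans)
  then show "integrable (positive_part M \<sigma>) (\<lambda>\<omega>. c * cmod (f \<omega>))"
    by auto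
  show "f \<in> borel_measurable (positive_part M \<sigma>)" "s n \<in> borel_measurable (positive_part M \<sigma>)" for n
    using f(1) s[of n] by simp_all
qed (rule AE_I2; simp add: lim bound)+

text \<open>The integral combines four integrals against the positive parts of the real part, the
  imaginary part and their negatives; each of these set functions is at most
  \<open>cmod (\<nu> E)\<close>.\<close>

lemma complex_integral_dominated:
  fixes s :: "nat \<Rightarrow> 'o \<Rightarrow> complex"
  assumes \<nu>: "complex_measure M \<nu>"
    and "f \<in> borel_measurable M" "(\<integral>\<^sup>+\<omega>. ennreal (cmod (f \<omega>)) \<partial>total_variation M \<nu>) < \<infinity>"
    and "\<And>n. s n \<in> borel_measurable M"
    and "\<And>\<omega>. \<omega> \<in> space M \<Longrightarrow> (\<lambda>n. s n \<omega>) \<longlonglongrightarrow> f \<omega>"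
    and "\<And>n \<omega>. \<omega> \<in> space M \<Longrightarrow> cmod (s n \<omega>) \<le> c * cmod (f \<omega>)"
  shows "(\<lambda>n. complex_integral M \<nu> (s n)) \<longlonglongrightarrow> complex_integral M \<nu> f"
proof -
  have *: "(\<lambda>n. integral\<^sup>L (positive_part M \<sigma>) (s n)) \<longlonglongrightarrow> integral\<^sup>L (positive_part M \<sigma>) f"
    if "vector_measure M \<sigma>" "\<And>E. \<sigma> E \<le> cmod (\<nu> E)" for \<sigma>
    by (rule integral_positive_part_dominated[OF assms(1) that(1) _ assms(2-6)]) (rule that(2))
  have "- Re z \<le> cmod z" "Im z \<le> cmod z" "- Im z \<le> cmod z" for z
    using abs_Re_le_cmod[of z] abs_Im_le_cmod[of z] by linarith+
  then show ?thesis
    unfolding complex_integral_def signed_integral_def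
    by (intro tendsto_intros * vector_measure_uminus vector_measure_Re vector_measure_Im \<nu>)
      (simp_all add: complex_Re_le_cmod)
qed

text \<open>Over a finite measure every simple function is integrable, so its Bochner integral is
  the finite sum over its values.\<close>

lemma integral_positive_part_simple:
  fixes s :: "'o \<Rightarrow> complex"
  assumes \<sigma>: "vector_measure M \<sigma>" and s: "simple_function M s"
  shows "integral\<^sup>L (positive_part M \<sigma>) s =
    (\<Sum>y\<in>s ` space M. measure (positive_part M \<sigma>) (s -` {y} \<inter> space M) *\<^sub>R y)"
proof -
  interpret finite_measure "positive_part M \<sigma>" by (rule finite_measure_positive_part[OF \<sigma>])
  have "Bochner_Integration.simple_bochner_integrable (positive_part M \<sigma>) s"
    using s by (simp add: simple_bochner_integrable.simps simple_function_def)
  then show ?thesis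
    by (simp flip: simple_bochner_integrable_eq_integral
        add: simple_bochner_integral_def vimage_def Int_def conj_commute)
qed

lemma signed_integral_simple:
  assumes \<sigma>: "vector_measure M \<sigma>" and s: "simple_function M s"
  shows "signed_integral M \<sigma> s = (\<Sum>y\<in>s ` space M. \<sigma> (s -` {y} \<inter> space M) *\<^sub>R y)"
proof -
  have "s -` {y} \<inter> space M \<in> sets M" for y
    using s by (rule simple_functionD)
  then show ?thesis
    using measure_positive_part_diff[OF \<sigma>]
    by (simp add: signed_integral_def integral_positive_part_simple s \<sigma> vector_measure_uminus
        flip: sum_subtractf scaleR_diff_left)
qed

text \<open>Positive parts do not depend linearly on \<open>\<nu>\<close>; for simple functions they
  recombine to \<open>\<nu>\<close> itself, which makes the integral visibly linear in
  \<open>\<nu>\<close>.\<close>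

lemma complex_integral_simple:
  assumes "complex_measure M \<nu>" "simple_function M s"
  shows "complex_integral M \<nu> s = (\<Sum>y\<in>s ` space M. \<nu> (s -` {y} \<inter> space M) * y)"
proof -
  have "complex_integral M \<nu> s =
      (\<Sum>y\<in>s ` space M. Re (\<nu> (s -` {y} \<inter> space M)) *\<^sub>R y + \<i> * (Im (\<nu> (s -` {y} \<inter> space M)) *\<^sub>R y))"
    using assms by (simp add: complex_integral_def signed_integral_simple vector_measure_Re
        vector_measure_Im sum_distrib_left sum.distrib)
  also have "\<dots> = (\<Sum>y\<in>s ` space M. \<nu> (s -` {y} \<inter> space M) * y)"
    by (intro sum.cong refl complex_eqI) (simp_all add: algebra_simps)
  finally show ?thesis .
qed

section \<open>Uniform boundedness on the dual space\<close>

text \<open>Completeness is what the Baire argument on the dual requires. The dual sits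
  isometrically among the bounded real-linear maps, and complex homogeneity survives limits
  there.\<close>

instance cdual :: (complex_normed_vector) complex_banach
proof
  fix X :: "nat \<Rightarrow> 'a cdual"
  assume X: "Cauchy X"
  have dist: "dist (blinfun_of_cdual a) (blinfun_of_cdual b) = dist a b" for a b :: "'a cdual"
    unfolding dist_norm by transfer simp
  have "Cauchy (\<lambda>n. blinfun_of_cdual (X n))"
    using X by (simp add: Cauchy_def dist)
  then obtain L where L: "(\<lambda>n. blinfun_of_cdual (X n)) \<longlonglongrightarrow> L"
    using Cauchy_convergent convergent_def by blast
  have "blinfun_apply L (c *\<^sub>C x) = c * blinfun_apply L x" for c x
  proof (rule LIMSEQ_unique)
    have lim: "(\<lambda>n. blinfun_apply (blinfun_of_cdual (X n)) z) \<longlonglongrightarrow> blinfun_apply L z" for z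
      by (intro tendsto_intros L)
    show "(\<lambda>n. blinfun_apply (blinfun_of_cdual (X n)) (c *\<^sub>C x)) \<longlonglongrightarrow> blinfun_apply L (c *\<^sub>C x)"
      by (rule lim)
    have "blinfun_apply (blinfun_of_cdual (X n)) (c *\<^sub>C x) = c * blinfun_apply (blinfun_of_cdual (X n)) x" for n
      using blinfun_of_cdual[of "X n"] by (simp add: bounded_clinear_functional_def)
    then show "(\<lambda>n. blinfun_apply (blinfun_of_cdual (X n)) (c *\<^sub>C x)) \<longlonglongrightarrow> c * blinfun_apply L x"
      by (simp add: tendsto_mult_left lim)
  qed
  then have "blinfun_of_cdual (Abs_cdual L) = L"
    by (intro Abs_cdual_inverse) (simp add: bounded_clinear_functional_def blinfun.bounded_linear_right)
  then have "X \<longlonglongrightarrow> Abs_cdual L"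
    using L by (simp add: tendsto_iff flip: dist)
  then show "convergent X"
    by (auto simp: convergent_def)
qed

text \<open>Banach-Steinhaus through Baire: the closed sets \<open>K m\<close> cover the space
  because convergent sequences are bounded, so one of them contains a ball, on which all
  \<open>T n\<close> share a bound.\<close>

lemma bounded_linear_pointwise_limit:
  fixes T :: "nat \<Rightarrow> 'a::banach \<Rightarrow> 'b::real_normed_vector"
  assumes lin: "\<And>n. linear (T n)"
    and cont: "\<And>n. continuous_on UNIV (T n)"
    and lim: "\<And>x. (\<lambda>n. T n x) \<longlonglongrightarrow> S x"
  shows "bounded_linear S"
proof -
  define K where "K m = {x. \<forall>n. norm (T n x) \<le> real m}" for m :: nat
  have closed: "closed (K m)" for m
    unfolding K_def by (intro closed_Collect_all closed_Collect_le continuous_intros cont)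
  have UN: "(\<Union>m. K m) = UNIV"
  proof (intro equalityI subset_UNIV subsetI)
    fix x
    have "Bseq (\<lambda>n. T n x)"
      using lim[of x] by (intro convergent_imp_Bseq) (auto simp: convergent_def)
    then obtain B where "\<And>n. norm (T n x) \<le> B"
      by (auto simp: Bseq_def)
    moreover obtain m :: nat where "B \<le> real m"
      using real_arch_simple by blast
    ultimately show "x \<in> (\<Union>m. K m)"
      by (auto simp: K_def intro: order_trans)
  qed
  have "\<exists>m. interior (K m) \<noteq> {}"
  proof (rule ccontr)
    assume "\<nexists>m. interior (K m) \<noteq> {}"
    then have "interior (\<Union>m. K m) = {}"
      using Met_TC.metric_Baire_category_alt[of "range K"] closed
      by (auto simp: complete_UNIV)
    then show False
      by (simp add: UN)
  qed
  then obtain m y where "y \<in> interior (K m)"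
    by blast
  then obtain e where e: "e > 0" "cball y e \<subseteq> K m"
    unfolding mem_interior_cball by blast
  have small: "norm (S x) \<le> 2 * real m" if x: "norm x \<le> e" for x
  proof (rule LIMSEQ_le_const2)
    show "(\<lambda>n. norm (T n x)) \<longlonglongrightarrow> norm (S x)"
      by (intro tendsto_norm lim)
    have "norm (T n x) \<le> 2 * real m" for n
    proof -
      \<comment> \<open>Subtracting the value at the centre moves the ball to the origin, at the
        cost of the factor 2.\<close>
      have "y + x \<in> K m" "y \<in> K m"
        using e x by (auto simp: dist_norm subset_iff)
      then have "norm (T n (y + x)) \<le> m" "norm (T n y) \<le> m"
        by (auto simp: K_def)
      moreover have "T n x = T n (y + x) - T n y"
        by (simp add: linear_add[OF lin])
      ultimately show ?thesis
        using norm_triangle_ineq4[of "T n (y + x)" "T n y"] by simp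
    qed
    then show "\<exists>N. \<forall>n\<ge>N. norm (T n x) \<le> 2 * real m"
      by blast
  qed
  have scale: "S (r *\<^sub>R x) = r *\<^sub>R S x" for r x
    using LIMSEQ_unique[OF lim[of "r *\<^sub>R x"]] tendsto_scaleR[OF tendsto_const lim[of x], of r]
    by (simp add: linear_cmul[OF lin])
  show ?thesis
  proof (rule bounded_linear_intro[where K = "2 * real m / e"])
    show "S (x + y) = S x + S y" for x y
      using LIMSEQ_unique[OF lim[of "x + y"]] tendsto_add[OF lim[of x] lim[of y]]
      by (simp add: linear_add[OF lin])
    fix x
    show "norm (S x) \<le> norm x * (2 * real m / e)"
    proof (cases "x = 0")
      case True
      then show ?thesis using scale[of 0 x] by simp
    next
      case False
      \<comment> \<open>Rescaling \<open>x\<close> to norm \<open>e\<close> brings it within reach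
        of \<open>small\<close>.\<close>
      then show ?thesis
        using small[of "(e / norm x) *\<^sub>R x"] e(1) by (simp add: scale field_simps)
    qed
  qed (rule scale)
qed

section \<open>Integrals as elements of the bidual, and the convergence theorem\<close>

lemma opf_L1D:
  assumes "f \<in> opf_L1 M \<mu>"
  shows "f \<in> borel_measurable M" "(\<integral>\<^sup>+\<omega>. ennreal (cmod (f \<omega>)) \<partial>total_variation M (\<mu> \<Lambda> x)) < \<infinity>"
  using assms by (auto simp: opf_L1_def)

context operator_projection_family
begin

text \<open>The continuity condition on filters is applied to the punctured neighbourhoods of each
  functional.\<close>

lemma continuous_on_left:
  assumes "E \<in> sets M"
  shows "continuous_on UNIV (\<lambda>\<Lambda>. \<mu> \<Lambda> x E)"
  using setwise_left[OF tendsto_ident_at] assms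
  by (simp add: continuous_on_def setwise_tendsto_def)

text \<open>Convergence in \<open>weak_star_topology\<close> takes place among bounded functionals,
  so this is needed for the limit and for the terms of the sequence.\<close>

lemma bounded_clinear_functional_opf_integral:
  assumes f: "f \<in> opf_L1 M \<mu>"
  shows "bounded_clinear_functional (opf_integral M \<mu> f x)"
proof -
  obtain s where s: "\<And>n. simple_function M (s n)"
    "\<And>\<omega>. \<omega> \<in> space M \<Longrightarrow> (\<lambda>n. s n \<omega>) \<longlonglongrightarrow> f \<omega>"
    "\<And>n \<omega>. \<omega> \<in> space M \<Longrightarrow> cmod (s n \<omega>) \<le> 2 * cmod (f \<omega>)"
    \<comment> \<open>The approximation bounds distances to a base point by a factor 2; the base
      point 0 turns this into a bound on moduli.\<close>
    using borel_measurable_implies_sequence_metric[OF opf_L1D(1)[OF f], of 0] by simp metis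
  \<comment> \<open>The integral of \<open>s n\<close>, written through values of
    \<open>\<mu>\<close> on sets that do not vary with the functional.\<close>
  define T where "T n \<Lambda> = (\<Sum>y\<in>s n ` space M. \<mu> \<Lambda> x (s n -` {y} \<inter> space M) * y)" for n \<Lambda>
  have sets: "s n -` {y} \<inter> space M \<in> sets M" for n y
    using s(1) by (rule simple_functionD)
  have "(\<lambda>n. complex_integral M (\<mu> \<Lambda> x) (s n)) \<longlonglongrightarrow> complex_integral M (\<mu> \<Lambda> x) f" for \<Lambda>
    using s by (intro complex_integral_dominated[OF complex_measure opf_L1D[OF f], where c = 2])
      (auto intro: borel_measurable_simple_function)
  then have lim: "(\<lambda>n. T n \<Lambda>) \<longlonglongrightarrow> opf_integral M \<mu> f x \<Lambda>" for \<Lambda>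
    by (simp add: T_def opf_integral_def complex_integral_simple[OF complex_measure s(1)])
  have scaleC: "T n (c *\<^sub>C \<Lambda>) = c * T n \<Lambda>" for n c \<Lambda>
    by (simp add: T_def scale_left sets sum_distrib_left mult.assoc)
  have "linear (T n)" for n
  proof (rule linearI)
    show "T n (\<Lambda> + \<Lambda>') = T n \<Lambda> + T n \<Lambda>'" for \<Lambda> \<Lambda>'
      by (simp add: T_def add_left sets distrib_right sum.distrib)
    \<comment> \<open>Real scalars are treated as complex ones, since only complex homogeneity is
      given.\<close>
    show "T n (r *\<^sub>R \<Lambda>) = r *\<^sub>R T n \<Lambda>" for r \<Lambda>
      using scaleC[of n "complex_of_real r" \<Lambda>] by (simp add: scaleC_of_real scaleR_conv_of_real)
  qed
  moreover have "continuous_on UNIV (T n)" for n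
    unfolding T_def by (intro continuous_intros continuous_on_left sets)
  ultimately have "bounded_linear (opf_integral M \<mu> f x)"
    using lim by (rule bounded_linear_pointwise_limit)
  \<comment> \<open>The limit lemma yields real linearity only, so complex homogeneity is passed to
    the limit separately.\<close>
  moreover have "opf_integral M \<mu> f x (c *\<^sub>C \<Lambda>) = c * opf_integral M \<mu> f x \<Lambda>" for c \<Lambda>
    using LIMSEQ_unique[OF lim[of "c *\<^sub>C \<Lambda>"]] tendsto_mult[OF tendsto_const lim[of \<Lambda>], of c]
    by (simp add: scaleC)
  ultimately show ?thesis
    by (simp add: bounded_clinear_functional_def)
qed

end

theorem mainTheorem6:
  fixes M :: "'o measure"
    and \<mu> :: "'x::complex_banach cdual \<Rightarrow> 'x \<Rightarrow> 'o set \<Rightarrow> complex"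
    and fs :: "nat \<Rightarrow> 'o \<Rightarrow> real" and f :: "'o \<Rightarrow> real"
  assumes "operator_projection_family M \<mu>"
    and "\<And>n. (\<lambda>\<omega>. complex_of_real (fs n \<omega>)) \<in> opf_L1 M \<mu>"
    and "\<And>n \<omega>. \<omega> \<in> space M \<Longrightarrow> 0 \<le> fs n \<omega>"
    and "\<And>m n \<omega>. m \<le> n \<Longrightarrow> \<omega> \<in> space M \<Longrightarrow> fs m \<omega> \<le> fs n \<omega>"
    and "\<And>\<omega>. \<omega> \<in> space M \<Longrightarrow> (\<lambda>n. fs n \<omega>) \<longlonglongrightarrow> f \<omega>"
    and "(\<lambda>\<omega>. complex_of_real (f \<omega>)) \<in> opf_L1 M \<mu>"
  shows "\<forall>x. limitin weak_star_topology
           (\<lambda>n. opf_integral M \<mu> (\<lambda>\<omega>. complex_of_real (fs n \<omega>)) x)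
           (opf_integral M \<mu> (\<lambda>\<omega>. complex_of_real (f \<omega>)) x) sequentially"
proof
  fix x
  interpret operator_projection_family M \<mu> by fact
  \<comment> \<open>Each term of a non-decreasing sequence lies below the limit, so \<open>f\<close>
    can serve as the dominating function.\<close>
  have le: "fs n \<omega> \<le> f \<omega>" if "\<omega> \<in> space M" for n \<omega>
    by (rule LIMSEQ_le_const[OF assms(5)[OF that]]) (use assms(4) that in blast)
  have "(\<lambda>n. complex_integral M (\<mu> \<Lambda> x) (\<lambda>\<omega>. complex_of_real (fs n \<omega>)))
      \<longlonglongrightarrow> complex_integral M (\<mu> \<Lambda> x) (\<lambda>\<omega>. complex_of_real (f \<omega>))" for \<Lambda>
  proof (rule complex_integral_dominated[OF complex_measure opf_L1D[OF assms(6)] opf_L1D(1)[OF assms(2)], where c = 1])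
    fix n \<omega> assume "\<omega> \<in> space M"
    then show "(\<lambda>n. complex_of_real (fs n \<omega>)) \<longlonglongrightarrow> complex_of_real (f \<omega>)"
      and "cmod (complex_of_real (fs n \<omega>)) \<le> 1 * cmod (complex_of_real (f \<omega>))"
      \<comment> \<open>Nonnegativity turns the order relation \<open>le\<close> into one between
        moduli.\<close>
      using assms(3)[of \<omega> n] assms(5)[of \<omega>] le[of \<omega> n] by (simp_all add: tendsto_of_real)
  qed
  then show "limitin weak_star_topology
      (\<lambda>n. opf_integral M \<mu> (\<lambda>\<omega>. complex_of_real (fs n \<omega>)) x)
      (opf_integral M \<mu> (\<lambda>\<omega>. complex_of_real (f \<omega>)) x) sequentially"
    unfolding limitin_weak_star_iff
    using bounded_clinear_functional_opf_integral assms(2,6) by (simp add: opf_integral_def)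
qed

end
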